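(* Let $(a_i)$ be a representing sequence with $a_1=k$, let $w$ be the representation word of $(a_i)$, and let $f$ be the $1$-promotion function of $(a_i)$. If $w$ is the Nim sequence of a set $S$ of positive integers that contains $\{1,2,\dots,k-1\}$, then $\varphi_k(w)$ is the Nim sequence of the set $S'=f(S)\cup\{1\}$, where $\varphi_k$ is the morphism from words over $\{0,\dots,k\}$ to words over $\{0,\dots,k+1\}$ given by $\varphi_k(0)=01$ and $\varphi_k(i)=i+1$ for $i>0$.
   Context: A representing sequence is a strictly increasing sequence $(a_i)_{i\ge0}$ of positive integers with $a_0=1$. For $n\ge1$ with $a_j\le n<a_{j+1}$, the $(a_i)$-representation of $n$ is the digit string $d_j\cdots d_0$ with $n=\sum d_ia_i$ and $\sum d_i$ minimal (greedy); the representation of $0$ is the digit $0$. $n\ge0$ is $2$-volatile if the representation of $n+1$ ends in at least two zeros. The representation word of $(a_i)$ is the infinite word $w$ with $w[n]=a_1$ if $n$ is $2$-volatile and otherwise $w[n]$ equals the last digit of the representation of $n$. The $1$-promotion of $(a_i)$ is $(b_i)_{i\ge0}$ with $b_0=1$ and, for $i\ge1$, writing $d_{i-1}\cdots d_0$ for the representation of $a_i-1$: $b_i=1+(d_0+1)b_0+\sum_{\ell=1}^{i-1}d_\ell b_\ell$ if $d_0>0$, else $b_i=1+\sum_{\ell=0}^{i-1}d_\ell b_\ell$. The $1$-promotion function $f$ is defined by $f(0)=0$ and, for $n\ge1$ with representation $d_i d_{i-1}\cdots d_0$: $f(n)=(d_0+1)b_0+\sum_{\ell=1}^{i}d_\ell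 b_\ell$ if $d_0>0$, else $f(n)=\sum_{\ell=0}^{i}d_\ell b_\ell$. For a set $S$ of positive integers, $\mathrm{SG}_S(n)=\mathrm{mex}\{\mathrm{SG}_S(n-s)\mid s\in S,s\le n\}$ and the Nim sequence of $S$ is $(\mathrm{SG}_S(n))_{n\ge0}$. *)

theory Defs
  imports Main "HOL-Library.Stream"
begin

definition representing_seq :: "(nat \<Rightarrow> nat) \<Rightarrow> bool" where
  "representing_seq a \<longleftrightarrow> strict_mono a \<and> a 0 = 1"

text \<open>Digit strings are stored least significant digit first: for \<open>ds = representation a n\<close>, the
  digit \<open>d\<^sub>l\<close> is \<open>ds ! l\<close>, so the string ends in \<open>ds ! 0\<close>. The representation is the greedy one; a
  decomposition of \<open>n\<close> with minimal digit sum need not be unique.\<close>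

primrec greedy_digits :: "(nat \<Rightarrow> nat) \<Rightarrow> nat \<Rightarrow> nat \<Rightarrow> nat list" where
  "greedy_digits a 0 n = [n div a 0]"
| "greedy_digits a (Suc j) n = greedy_digits a j (n mod a (Suc j)) @ [n div a (Suc j)]"

definition representation :: "(nat \<Rightarrow> nat) \<Rightarrow> nat \<Rightarrow> nat list" where
  "representation a n =
     (if n = 0 then [0] else greedy_digits a (THE j. a j \<le> n \<and> n < a (Suc j)) n)"

definition two_volatile :: "(nat \<Rightarrow> nat) \<Rightarrow> nat \<Rightarrow> bool" where
  "two_volatile a n \<longleftrightarrow>
     (let ds = representation a (n + 1) in 2 \<le> length ds \<and> ds ! 0 = 0 \<and> ds ! 1 = 0)"

definition representation_word :: "(nat \<Rightarrow> nat) \<Rightarrow> nat stream" where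
  "representation_word a =
     smap (\<lambda>n. if two_volatile a n then a 1 else representation a n ! 0) nats"

fun one_promotion :: "(nat \<Rightarrow> nat) \<Rightarrow> nat \<Rightarrow> nat" where
  "one_promotion a i =
     (if i = 0 then 1
      else let ds = representation a (a i - 1) in
        if ds ! 0 > 0
        then 1 + (ds ! 0 + 1) * one_promotion a 0 + (\<Sum>l = 1..<i. ds ! l * one_promotion a l)
        else 1 + (\<Sum>l = 0..<i. ds ! l * one_promotion a l))"

declare one_promotion.simps [simp del]

definition one_promotion_fun :: "(nat \<Rightarrow> nat) \<Rightarrow> nat \<Rightarrow> nat" where
  "one_promotion_fun a n =
     (if n = 0 then 0
      else let ds = representation a n in
        if ds ! 0 > 0
        then (ds ! 0 + 1) * one_promotion a 0
               + (\<Sum>l = 1..<length ds. ds ! l * one_promotion a l)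
        else (\<Sum>l = 0..<length ds. ds ! l * one_promotion a l))"

definition mex :: "nat set \<Rightarrow> nat" where
  "mex X = (LEAST m. m \<notin> X)"

text \<open>The guard \<open>0 < s\<close> only serves termination; it is vacuous for sets of positive integers.\<close>

function SG :: "nat set \<Rightarrow> nat \<Rightarrow> nat" where
  "SG S n = mex ((\<lambda>s. SG S (n - s)) ` {s \<in> S. 0 < s \<and> s \<le> n})"
  by auto
termination by (relation "measure snd") auto

declare SG.simps [simp del]

definition nim_sequence :: "nat set \<Rightarrow> nat stream" where
  "nim_sequence S = smap (SG S) nats"

text \<open>Action of a non-erasing morphism, given by its letter images, on an infinite word.\<close>

definition apply_morphism :: "('a \<Rightarrow> 'b list) \<Rightarrow> 'a stream \<Rightarrow> 'b stream" where
  "apply_morphism h w = flat (smap h w)"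

text \<open>The alphabet of \<open>\<phi>\<^sub>k\<close> is \<open>{0..k}\<close>; letters outside it are sent to an unspecified value. Lemma
  \<open>representation_word_alphabet\<close> shows that they do not occur in the words considered.\<close>

definition phi :: "nat \<Rightarrow> nat \<Rightarrow> nat list" where
  "phi k i = (if i = 0 then [0, 1] else if i \<le> k then [i + 1] else undefined)"

lemma greedy_digits_sum:
  assumes "a 0 = 1"
  shows "length (greedy_digits a j n) = Suc j"
    and "(\<Sum>l = 0..<Suc j. greedy_digits a j n ! l * a l) = n"
proof -
  show len: "length (greedy_digits a j n) = Suc j" for j n
    by (induction j arbitrary: n) auto
  show "(\<Sum>l = 0..<Suc j. greedy_digits a j n ! l * a l) = n"
  proof (induction j arbitrary: n)
    case 0
    then show ?case using assms by simp
  next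
    case (Suc j)
    have "(\<Sum>l = 0..<Suc j. greedy_digits a (Suc j) n ! l * a l)
        = (\<Sum>l = 0..<Suc j. greedy_digits a j (n mod a (Suc j)) ! l * a l)"
      by (rule sum.cong) (simp_all add: nth_append len)
    then have "(\<Sum>l = 0..<Suc j. greedy_digits a (Suc j) n ! l * a l) = n mod a (Suc j)"
      using Suc.IH by simp
    then show ?case
      by (subst sum.atLeast0_lessThan_Suc) (simp add: nth_append len)
  qed
qed

lemma representing_seq_bracket:
  assumes "representing_seq a" and "0 < n"
  shows "\<exists>!j. a j \<le> n \<and> n < a (Suc j)"
proof -
  have sm: "strict_mono a" and a0: "a 0 = 1"
    using assms by (auto simp: representing_seq_def)
  have bd: "j \<le> n" if "a j \<le> n" for j
    using strict_mono_imp_increasing[OF sm, of j] that by simp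
  define j where "j = (GREATEST j. a j \<le> n)"
  have "a j \<le> n" unfolding j_def
    by (rule GreatestI_nat[where k = 0 and b = n]) (use assms a0 bd in auto)
  moreover have "n < a (Suc j)"
  proof (rule ccontr)
    assume "\<not> n < a (Suc j)"
    then have "Suc j \<le> j" unfolding j_def
      by (intro Greatest_le_nat[where b = n]) (use bd in auto)
    then show False by simp
  qed
  moreover have "i = i'"
    if "a i \<le> n" "n < a (Suc i)" "a i' \<le> n" "n < a (Suc i')" for i i'
  proof -
    have "a i < a (Suc i')" "a i' < a (Suc i)" using that by simp_all
    then have "i < Suc i'" "i' < Suc i" using strict_mono_less[OF sm] by blast+
    then show ?thesis by simp
  qed
  ultimately show ?thesis by blast
qed

lemma representation_sum:
  assumes "representing_seq a"
  shows "(\<Sum>l = 0..<length (representation a n). representation a n ! l * a l) = n"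
  using assms greedy_digits_sum[of a]
  by (auto simp: representation_def representing_seq_def)

lemma representation_word_alphabet:
  assumes "representing_seq a"
  shows "sset (representation_word a) \<subseteq> {0..a 1}"
proof -
  have sm: "strict_mono a" and a0: "a 0 = 1"
    using assms by (auto simp: representing_seq_def)
  have a1: "0 < a (Suc 0)" using strict_monoD[OF sm, of 0 "Suc 0"] by simp
  have gd: "greedy_digits a j n ! 0 \<le> a 1" if "n < a (Suc j)" for j n
    using that
  proof (induction j arbitrary: n)
    case 0
    then show ?case using a0 by simp
  next
    case (Suc j)
    have "0 < a (Suc j)" using strict_monoD[OF sm, of 0 "Suc j"] by simp
    then have "greedy_digits a j (n mod a (Suc j)) ! 0 \<le> a 1"
      by (intro Suc.IH) simp
    then show ?case using greedy_digits_sum(1)[of a, OF a0] by (simp add: nth_append)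
  qed
  have "representation a n ! 0 \<le> a 1" for n
  proof (cases "n = 0")
    case False
    then show ?thesis
      using theI'[OF representing_seq_bracket[OF assms, of n]] gd
      by (simp add: representation_def)
  qed (simp add: representation_def)
  then show ?thesis by (auto simp: representation_word_def stream.set_map)
qed

end

theory Submission
  imports Defs
begin

text \<open>Greedy digits and the Nim property together cut the representation word \<open>w\<close> into blocks
  \<open>0 1 \<dots> k - 1\<close> and \<open>0 1 \<dots> k\<close>, and the promotion function \<open>f\<close> sends a position \<open>n\<close> of \<open>w\<close> to the
  position where the image of \<open>w[n]\<close> starts in \<open>\<phi>\<^sub>k(w)\<close>. For \<open>s \<in> S\<close>, the zeros of \<open>w\<close> shifted by \<open>s\<close>
  avoid the zeros of \<open>w\<close>; as all gaps between zeros are \<open>k\<close> or \<open>k + 1\<close>, the two sets interlace, whence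
  \<open>f (m + s) = f m + f s\<close> whenever \<open>w[m] = 0\<close>. In \<open>\<phi>\<^sub>k(w)\<close> every letter is its offset within a block,
  so equal letters at a distance in \<open>f(S) \<union> {1}\<close> would give two zeros of \<open>w\<close> at a distance in \<open>S\<close>. Conversely,
  smaller letters are reached inside the block by \<open>1, \<dots>, k\<close>, except \<open>0\<close> from \<open>k + 1\<close>, which is
  reached by additivity from the corresponding move in \<open>w\<close>.\<close>

section \<open>Greedy digits and the promotion function\<close>

text \<open>Covers both cases of the promotion formulas: raising a nonzero \<open>ds ! 0\<close>
  adds one copy of the weight \<open>b 0\<close>, taken to be 1.\<close>

definition promoted_value :: "(nat \<Rightarrow> nat) \<Rightarrow> nat list \<Rightarrow> nat" where
  "promoted_value b ds = (if 0 < ds ! 0 then 1 else 0) + (\<Sum>l<length ds. ds ! l * b l)"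

lemma promoted_value_append:
  "ds \<noteq> [] \<Longrightarrow> promoted_value b (ds @ [q]) = promoted_value b ds + q * b (length ds)"
  by (simp add: promoted_value_def nth_append)

lemma promoted_value_append_zeros:
  "ds \<noteq> [] \<Longrightarrow> promoted_value b (ds @ replicate i 0) = promoted_value b ds"
proof (induction i)
  case (Suc i)
  have "ds @ replicate (Suc i) 0 = (ds @ replicate i 0) @ [0]"
    by (simp add: replicate_append_same)
  then show ?case
    using Suc promoted_value_append[of "ds @ replicate i 0" b 0] by (simp del: append_assoc)
qed simp

lemma promoted_value_split:
  assumes "ds \<noteq> []" and "b 0 = 1"
  shows "promoted_value b ds =
    (if 0 < ds ! 0 then (ds ! 0 + 1) * b 0 + (\<Sum>l = 1..<length ds. ds ! l * b l)
     else (\<Sum>l = 0..<length ds. ds ! l * b l))"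
proof -
  have "(\<Sum>l<length ds. ds ! l * b l) = ds ! 0 * b 0 + (\<Sum>l = 1..<length ds. ds ! l * b l)"
    using assms sum.atLeast_Suc_lessThan[of 0 "length ds" "\<lambda>l. ds ! l * b l"]
    by (simp add: atLeast0LessThan)
  then show ?thesis
    using assms by (simp add: promoted_value_def atLeast0LessThan)
qed

lemma length_greedy_digits [simp]: "length (greedy_digits a j n) = Suc j"
  by (induction j arbitrary: n) auto

lemma greedy_digits_ne_Nil [simp]: "greedy_digits a j n \<noteq> []"
  using length_greedy_digits[of a j n] by (metis list.size(3) nat.distinct(1))

lemma greedy_digits_of_0: "greedy_digits a j 0 = replicate (Suc j) 0"
  by (induction j) (auto simp: replicate_append_same)

lemma greedy_digits_Suc_nth:
  "l \<le> j \<Longrightarrow> greedy_digits a (Suc j) n ! l = greedy_digits a j (n mod a (Suc j)) ! l"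
  by (simp add: nth_append)

lemma representing_seq_gt_index: "representing_seq a \<Longrightarrow> i < a i"
proof (induction i)
  case 0
  then show ?case by (simp add: representing_seq_def)
next
  case (Suc i)
  then have "a i < a (Suc i)" by (simp add: representing_seq_def strict_mono_Suc_iff)
  then show ?case using Suc by simp
qed

lemma representing_seq_pos: "representing_seq a \<Longrightarrow> 0 < a i"
  using representing_seq_gt_index[of a i] by simp

lemma greedy_digits_pad:
  assumes "representing_seq a" and "n < a (Suc j)"
  shows "greedy_digits a (j + i) n = greedy_digits a j n @ replicate i 0"
proof (induction i)
  case (Suc i)
  have "a (Suc j) \<le> a (Suc (j + i))"
    using assms by (simp add: representing_seq_def strict_mono_less_eq)
  then have "n < a (Suc (j + i))" using assms by simp
  then show ?case using Suc by (simp add: replicate_append_same)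
qed simp

lemma representation_eq_greedy_digits:
  assumes "representing_seq a" and "a j \<le> n" and "n < a (Suc j)"
  shows "representation a n = greedy_digits a j n"
proof -
  have "0 < n" using assms representing_seq_pos[OF assms(1), of j] by simp
  then have "(THE j. a j \<le> n \<and> n < a (Suc j)) = j"
    using representing_seq_bracket[OF assms(1)] assms by (intro the1_equality) auto
  then show ?thesis using \<open>0 < n\<close> by (simp add: representation_def)
qed

text \<open>A fixed top index \<open>J\<close> lets the digits of \<open>n\<close> and
  \<open>Suc n\<close> be compared at equal length; \<open>n \<le> J\<close> suffices because
  \<open>j < a j\<close>.\<close>

lemma greedy_digits_eq_representation:
  assumes "representing_seq a" and "n \<le> J"
  obtains i where "greedy_digits a J n = representation a n @ replicate i 0"
    and "representation a n \<noteq> []"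
proof (cases "n = 0")
  case True
  then show ?thesis
    using that[of J] by (simp add: greedy_digits_of_0 representation_def)
next
  case False
  then obtain j where j: "a j \<le> n" "n < a (Suc j)"
    using representing_seq_bracket[OF assms(1), of n] by auto
  then have "j \<le> J" using representing_seq_gt_index[OF assms(1), of j] assms by simp
  then show ?thesis
    using that[of "J - j"] greedy_digits_pad[OF assms(1) j(2), of "J - j"]
      representation_eq_greedy_digits[OF assms(1) j] by simp
qed

lemma representation_nth_0:
  assumes "representing_seq a" and "n \<le> J"
  shows "representation a n ! 0 = greedy_digits a J n ! 0"
  using greedy_digits_eq_representation[OF assms] by (metis length_greater_0_conv nth_append)

text \<open>Padding with leading zeros cannot create a spurious pair of final zeros, because a positive
  number with a one-digit representation has a nonzero digit.\<close>

lemma two_volatile_iff_greedy_digits: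
  assumes "representing_seq a" and "n < J"
  shows "two_volatile a n \<longleftrightarrow> greedy_digits a J (Suc n) ! 0 = 0 \<and> greedy_digits a J (Suc n) ! 1 = 0"
proof -
  from assms obtain i where i: "greedy_digits a J (Suc n) = representation a (Suc n) @ replicate i 0"
    "representation a (Suc n) \<noteq> []"
    using greedy_digits_eq_representation[OF assms(1), of "Suc n" J] by auto
  show ?thesis
  proof (cases "length (representation a (Suc n)) = 1")
    case True
    then have "representation a (Suc n) ! 0 \<noteq> 0"
      using representation_sum[OF assms(1), of "Suc n"] by (intro notI) simp
    then show ?thesis using i by (simp add: two_volatile_def nth_append)
  next
    case False
    then have "2 \<le> length (representation a (Suc n))"
      using i(2) by (cases "representation a (Suc n)") (auto simp: Suc_le_eq)
    then show ?thesis by (simp add: two_volatile_def Let_def i nth_append)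
  qed
qed

lemma one_promotion_0 [simp]: "one_promotion a 0 = 1"
  by (simp add: one_promotion.simps)

lemma one_promotion_Suc:
  assumes "representing_seq a"
  shows "one_promotion a (Suc i) =
    Suc (promoted_value (one_promotion a) (greedy_digits a i (a (Suc i) - 1)))"
proof -
  have "a i < a (Suc i)" using assms by (simp add: representing_seq_def strict_mono_Suc_iff)
  then have "representation a (a (Suc i) - 1) = greedy_digits a i (a (Suc i) - 1)"
    using assms by (intro representation_eq_greedy_digits) auto
  then show ?thesis
    by (subst one_promotion.simps) (simp add: promoted_value_split Let_def del: sum.op_ivl_Suc)
qed

lemma one_promotion_fun_eq:
  assumes "representing_seq a" and "n \<le> J"
  shows "one_promotion_fun a n = promoted_value (one_promotion a) (greedy_digits a J n)"
proof -
  obtain i where i: "greedy_digits a J n = representation a n @ replicate i 0"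
    "representation a n \<noteq> []"
    using greedy_digits_eq_representation[OF assms] .
  have "one_promotion_fun a n = promoted_value (one_promotion a) (representation a n)"
    using i(2)
    by (simp add: one_promotion_fun_def promoted_value_split Let_def)
       (simp add: representation_def)
  then show ?thesis using i by (simp add: promoted_value_append_zeros)
qed

lemma Suc_div_mod_cases:
  fixes n m :: nat
  assumes "0 < m"
  obtains "Suc n mod m = Suc (n mod m)" "Suc n div m = n div m"
  | "Suc n mod m = 0" "Suc n div m = Suc (n div m)" "n mod m = m - 1"
  using assms by (cases "Suc (n mod m) = m") (auto simp: mod_Suc div_Suc)

text \<open>In a carry into \<open>a (Suc j)\<close> the lower digits pass from those of
  \<open>a (Suc j) - 1\<close> to zeros; \<open>one_promotion a (Suc j)\<close> exceeds their
  promoted value by exactly 1, so \<open>G\<close> grows by 1.\<close>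

lemma greedy_digits_successor:
  fixes a :: "nat \<Rightarrow> nat"
  defines "G \<equiv> \<lambda>j n. promoted_value (one_promotion a) (greedy_digits a j n)"
  assumes "representing_seq a"
  shows "greedy_digits a j (Suc n) ! 0 = 0 \<and> G j (Suc n) = Suc (G j n) \<or>
    greedy_digits a j (Suc n) ! 0 = Suc (greedy_digits a j n ! 0) \<and>
    G j (Suc n) = G j n + (if greedy_digits a j n ! 0 = 0 then 2 else 1)"
proof (induction j arbitrary: n)
  case 0
  then show ?case
    using assms by (simp add: representing_seq_def promoted_value_def)
next
  case (Suc j)
  let ?m = "a (Suc j)"
  have G: "G (Suc j) n = G j (n mod ?m) + n div ?m * one_promotion a (Suc j)" for n
    by (simp add: G_def promoted_value_append)
  have "0 < ?m" using assms(2) by (rule representing_seq_pos)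
  then show ?case
  proof (cases rule: Suc_div_mod_cases[of ?m n])
    case 1
    then show ?thesis
      using Suc.IH[of "n mod ?m"] by (auto simp: G greedy_digits_Suc_nth simp del: greedy_digits.simps)
  next
    case 2
    have "G j 0 = 0"
      by (simp add: G_def greedy_digits_of_0 promoted_value_def del: replicate_Suc)
    moreover have "one_promotion a (Suc j) = Suc (G j (?m - 1))"
      using one_promotion_Suc[OF assms(2)] by (simp add: G_def)
    ultimately show ?thesis
      using 2 by (simp add: G greedy_digits_Suc_nth greedy_digits_of_0 del: greedy_digits.simps)
  qed
qed

text \<open>A carry into an index above 1 would clear digit 1, so the carry goes into
  \<open>a 1\<close>, from remainder \<open>a 1 - 1\<close>.\<close>

lemma greedy_digits_before_single_zero:
  assumes "representing_seq a"
    and "greedy_digits a (Suc j) (Suc n) ! 0 = 0" and "greedy_digits a (Suc j) (Suc n) ! 1 \<noteq> 0"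
  shows "greedy_digits a (Suc j) n ! 0 = a 1 - 1"
  using assms(2,3)
proof (induction j arbitrary: n)
  case 0
  have "a 0 = 1" using assms(1) by (simp add: representing_seq_def)
  have "0 < a 1" using assms(1) by (rule representing_seq_pos)
  then show ?case
    by (cases rule: Suc_div_mod_cases[of "a 1" n]) (use 0 \<open>a 0 = 1\<close> in auto)
next
  case (Suc j)
  let ?m = "a (Suc (Suc j))"
  have "0 < ?m" using assms(1) by (rule representing_seq_pos)
  then show ?case
  proof (cases rule: Suc_div_mod_cases[of ?m n])
    case 1
    then show ?thesis
      using Suc by (simp add: greedy_digits_Suc_nth del: greedy_digits.simps)
  next
    case 2
    then show ?thesis
      using Suc.prems(2) by (simp add: greedy_digits_Suc_nth greedy_digits_of_0 del: greedy_digits.simps)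
  qed
qed

section \<open>Transitions of the representation word\<close>

declare snth.simps [simp del]

lemma representation_word_nth:
  "representation_word a !! n = (if two_volatile a n then a 1 else representation a n ! 0)"
  by (simp add: representation_word_def)

lemma representation_nth_0_Suc_cases:
  assumes "representing_seq a"
  shows "representation a (Suc n) ! 0 = 0 \<and>
      one_promotion_fun a (Suc n) = Suc (one_promotion_fun a n) \<or>
    representation a (Suc n) ! 0 = Suc (representation a n ! 0) \<and>
      one_promotion_fun a (Suc n) =
        one_promotion_fun a n + (if representation a n ! 0 = 0 then 2 else 1)"
  using greedy_digits_successor[OF assms, of "Suc n" n]
  by (simp add: one_promotion_fun_eq[OF assms, of _ "Suc n"]
      representation_nth_0[OF assms, of _ "Suc n"] del: greedy_digits.simps)

lemma representation_before_single_zero: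
  assumes "representing_seq a"
    and "representation a (Suc n) ! 0 = 0" and "\<not> two_volatile a n"
  shows "representation a n ! 0 = a 1 - 1"
  using assms greedy_digits_before_single_zero[OF assms(1), of n n]
  by (simp add: two_volatile_iff_greedy_digits[OF assms(1), of _ "Suc n"]
      representation_nth_0[OF assms(1), of _ "Suc n"] del: greedy_digits.simps)

lemma two_volatile_imp_representation_nth_0:
  assumes "two_volatile a n"
  shows "representation a (Suc n) ! 0 = 0"
  using assms by (simp add: two_volatile_def Let_def)

lemma representing_seq_1_ge_2: "representing_seq a \<Longrightarrow> 2 \<le> a 1"
  using representing_seq_gt_index[of a 1] by simp

text \<open>The last digit drops to 0 only after a volatile position, with letter
  \<open>a 1\<close>, or after the digit \<open>a 1 - 1\<close>; both letters are positive.\<close>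

lemma one_promotion_fun_Suc:
  assumes "representing_seq a"
  shows "one_promotion_fun a (Suc n) =
    one_promotion_fun a n + (if representation_word a !! n = 0 then 2 else 1)"
  using representation_nth_0_Suc_cases[OF assms, of n] representing_seq_1_ge_2[OF assms]
    representation_before_single_zero[OF assms, of n] two_volatile_imp_representation_nth_0[of a n]
  by (auto simp: representation_word_nth)

lemma one_promotion_fun_0 [simp]: "one_promotion_fun a 0 = 0"
  by (simp add: one_promotion_fun_def)

lemma representation_word_0:
  assumes "representing_seq a"
  shows "representation_word a !! 0 = 0"
proof -
  have "representation a 0 ! 0 = 0" by (simp add: representation_def)
  moreover have "\<not> two_volatile a 0"
    using representation_before_single_zero[OF assms, of 0] representation_nth_0_Suc_cases[OF assms, of 0]
      representation_nth_0[OF assms, of "Suc 0" "Suc 0"] two_volatile_imp_representation_nth_0[of a 0]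
      representing_seq_1_ge_2[OF assms] assms
    by (auto simp: representing_seq_def)
  ultimately show ?thesis by (simp add: representation_word_nth)
qed

text \<open>The exception is a volatile \<open>Suc n\<close>: the last digit at \<open>n + 2\<close>
  is then 0, and only volatility decides the letter there.\<close>

lemma representation_word_Suc_cases:
  assumes "representing_seq a"
  shows "representation_word a !! Suc n \<in> {0, Suc (representation_word a !! n)} \<or>
    representation_word a !! Suc n = a 1 \<and> representation_word a !! Suc (Suc n) \<in> {0, a 1}"
  using representation_nth_0_Suc_cases[OF assms, of n] two_volatile_imp_representation_nth_0[of a n]
    two_volatile_imp_representation_nth_0[of a "Suc n"]
  by (auto simp: representation_word_nth)

lemma representation_word_le:
  assumes "representing_seq a"
  shows "representation_word a !! n \<le> a 1"
  using subsetD[OF representation_word_alphabet[OF assms] snth_sset] by simp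

section \<open>Nim values\<close>

lemma mex_notin: "finite X \<Longrightarrow> mex X \<notin> X"
  unfolding mex_def by (rule LeastI_ex) (rule ex_new_if_finite[OF infinite_UNIV_nat])

lemma in_if_less_mex: "v < mex X \<Longrightarrow> v \<in> X"
  unfolding mex_def using not_less_Least by blast

lemma SG_diff_neq: "s \<in> S \<Longrightarrow> 0 < s \<Longrightarrow> s \<le> n \<Longrightarrow> SG S (n - s) \<noteq> SG S n"
  using mex_notin[of "(\<lambda>s. SG S (n - s)) ` {s \<in> S. 0 < s \<and> s \<le> n}"] SG.simps[of S n]
  by force

lemma SG_option:
  assumes "v < SG S n"
  obtains s where "s \<in> S" "0 < s" "s \<le> n" "SG S (n - s) = v"
  using assms by (subst (asm) SG.simps) (auto dest!: in_if_less_mex)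

lemma SG_eqI:
  assumes neq: "\<And>n s. s \<in> S \<Longrightarrow> 0 < s \<Longrightarrow> s \<le> n \<Longrightarrow> w (n - s) \<noteq> w n"
    and opt: "\<And>n v. v < w n \<Longrightarrow> \<exists>s\<in>S. 0 < s \<and> s \<le> n \<and> w (n - s) = v"
  shows "SG S n = w n"
proof (induction n rule: less_induct)
  case (less n)
  let ?X = "(\<lambda>s. SG S (n - s)) ` {s \<in> S. 0 < s \<and> s \<le> n}"
  have X: "?X = (\<lambda>s. w (n - s)) ` {s \<in> S. 0 < s \<and> s \<le> n}"
    using less by (intro image_cong) auto
  have "mex ?X = w n"
    unfolding mex_def
  proof (rule Least_equality)
    show "w n \<notin> ?X" unfolding X using neq by fastforce
    show "w n \<le> v" if "v \<notin> ?X" for v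
      using that opt[of v n] unfolding X by (cases "v < w n") auto
  qed
  with SG.simps[of S n] show ?case by (rule trans)
qed

section \<open>Words made of increasing blocks\<close>

text \<open>A positive letter arises only by an increment. Steps are assumed only below
  \<open>n\<close>, which permits use inside a strong induction proving the step property.\<close>

lemma staircase_diff:
  fixes w :: "nat \<Rightarrow> nat"
  assumes "w 0 = 0" and "\<And>m. m < n \<Longrightarrow> w (Suc m) \<in> {0, Suc (w m)}" and "j \<le> w n"
  shows "j \<le> n \<and> w (n - j) = w n - j"
  using assms(3)
proof (induction j)
  case (Suc j)
  then have j: "j \<le> n" "w (n - j) = w n - j" "0 < w n - j" by auto
  then have "n - j \<noteq> 0" using assms(1) by (metis less_numeral_extra(3))
  then have "Suc (n - Suc j) = n - j" "n - Suc j < n" using j by auto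
  then show ?case using assms(2)[of "n - Suc j"] j by auto
qed simp

text \<open>A word cut into blocks \<open>0 1 \<dots> k - 1\<close> and \<open>0 1 \<dots> k\<close>, together with the position map \<open>f\<close> of its
  image under \<open>\<phi>\<^sub>k\<close>: the image of the letter at position \<open>n\<close> starts at \<open>f n\<close>.\<close>

locale nim_block_word =
  fixes k :: nat and S :: "nat set" and w f :: "nat \<Rightarrow> nat"
  assumes k: "2 \<le> k"
    and S_pos: "s \<in> S \<Longrightarrow> 0 < s"
    and S_interval: "{1..k - 1} \<subseteq> S"
    and w_nim: "w n = SG S n"
    and w_0: "w 0 = 0"
    and w_step: "w (Suc n) \<in> {0, Suc (w n)}"
    and w_le: "w n \<le> k"
    and f_0: "f 0 = 0"
    and f_Suc: "f (Suc n) = f n + (if w n = 0 then 2 else 1)"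
begin

lemma w_diff: "j \<le> w n \<Longrightarrow> j \<le> n \<and> w (n - j) = w n - j"
  using w_0 w_step by (rule staircase_diff)

lemma w_add_neq: "s \<in> S \<Longrightarrow> w (n + s) \<noteq> w n"
  using SG_diff_neq[of s S "n + s"] S_pos by (simp add: w_nim)

lemma strict_mono_f: "strict_mono f"
  by (simp add: strict_mono_Suc_iff f_Suc)

lemma f_add: "f (n + j) = f n + j + card {i \<in> {n..<n + j}. w i = 0}"
proof (induction j)
  case (Suc j)
  have "{i \<in> {n..<n + Suc j}. w i = 0} =
      (if w (n + j) = 0 then insert (n + j) {i \<in> {n..<n + j}. w i = 0} else {i \<in> {n..<n + j}. w i = 0})"
    by (auto simp: less_Suc_eq)
  then show ?case using Suc by (simp add: f_Suc)
qed simp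

text \<open>Consecutive zeros are \<open>k\<close> or \<open>k + 1\<close> apart, and so the zeros of \<open>w\<close> shifted by \<open>s \<in> S\<close>, which
  never hit a zero, interlace with the zeros of \<open>w\<close>.\<close>

lemma f_add_S:
  assumes "s \<in> S" and "w m = 0"
  shows "f (m + s) = f m + f s"
  using assms(2)
proof (induction m rule: less_induct)
  case (less m)
  show ?case
  proof (cases m)
    case 0
    then show ?thesis by (simp add: f_0)
  next
    case (Suc m')
    \<comment> \<open>\<open>z\<close> will be the last zero before \<open>m\<close>, and
      \<open>Suc c\<close> the gap between them.\<close>
    define c where "c = w m'"
    define z where "z = m' - c"
    have c: "c \<le> m'" "w z = 0" "c \<le> k"
      using w_diff[of c m'] w_le[of m'] by (auto simp: c_def z_def)
    have m: "m = z + Suc c" using Suc c by (simp add: z_def)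
    have "Suc c \<notin> S" using w_add_neq[of "Suc c" z] c less.prems m by auto
    then have "k \<le> Suc c" using S_interval by force
    have block: "w i \<noteq> 0" if "z < i" "i < m" for i
      using w_diff[of "m' - i" m'] that m Suc by (auto simp: c_def z_def)
    have "i \<in> {z..<z + Suc c} \<and> w i = 0 \<longleftrightarrow> i = z" for i
      using block[of i] m c by (cases "i = z") auto
    then have "{i \<in> {z..<z + Suc c}. w i = 0} = {z}"
      by (simp add: set_eq_iff)
    then have fm: "f m = f z + Suc c + 1" unfolding m by (subst f_add) simp
    have ends: "w (z + s) \<noteq> 0" "w (m + s) \<noteq> 0"
      using w_add_neq[OF assms(1)] c less.prems by metis+
    define u where "u = m' + s - w (m' + s)"
    have u: "w u = 0" "w (m' + s) \<le> m' + s"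
      using w_diff[of "w (m' + s)" "m' + s"] by (auto simp: u_def)
    \<comment> \<open>Otherwise the letters rise from \<open>w (z + s) \<ge> 1\<close> through
      \<open>Suc c \<ge> k\<close> steps and exceed \<open>k\<close>.\<close>
    have "\<exists>i\<in>{z + s..<m + s}. w i = 0"
    proof (cases "z + s \<le> u")
      case True
      then show ?thesis using u Suc by (intro bexI[of _ u]) (auto simp: u_def)
    next
      case False
      then have "w (z + s) = w (m' + s) - (m' - z)"
        using w_diff[of "m' - z" "m' + s"] c by (auto simp: u_def z_def)
      moreover have "w (m + s) = Suc (w (m' + s))"
        using w_step[of "m' + s"] ends Suc by auto
      moreover have "m' - z = c" using c by (simp add: z_def)
      ultimately show ?thesis
        using ends \<open>k \<le> Suc c\<close> w_le[of "m + s"] by auto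
    qed
    then obtain i where i: "i \<in> {z + s..<m + s}" "w i = 0" by blast
    \<comment> \<open>As \<open>z + s\<close> is no zero, two zeros here would be at most
      \<open>c - 1 \<le> k - 1\<close> apart, a distance in \<open>S\<close>.\<close>
    have "i' = i" if i': "i' \<in> {z + s..<m + s}" "w i' = 0" for i'
    proof (rule ccontr)
      assume ne: "i' \<noteq> i"
      have "i \<noteq> z + s" "i' \<noteq> z + s" using i i' ends by auto
      then have "max i i' - min i i' \<in> {1..k - 1}"
        using ne i i' m c by (auto simp: max_def min_def)
      then have "max i i' - min i i' \<in> S" using S_interval by blast
      then show False
        using w_add_neq[of "max i i' - min i i'" "min i i'"] i i'
        by (auto simp: max_def min_def split: if_splits)
    qed
    \<comment> \<open>With one zero in each interval, \<open>f\<close> grows equally from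
      \<open>z\<close> to \<open>m\<close> and from \<open>z + s\<close> to \<open>m + s\<close>;
      the claim descends to \<open>z\<close>.\<close>
    then have "{x \<in> {z + s..<m + s}. w x = 0} = {i}"
      using i by blast
    moreover have "m + s = (z + s) + Suc c" using m by simp
    ultimately have "f (m + s) = f (z + s) + Suc c + 1"
      using f_add[of "z + s" "Suc c"] by (simp add: add_ac)
    moreover have "f (z + s) = f z + f s" using less.IH[of z] m c by simp
    ultimately show ?thesis using fm by simp
  qed
qed

lemma f_interval:
  assumes "1 \<le> j" and "j \<le> k - 1"
  shows "f j = Suc j"
  using assms
proof (induction j rule: nat_induct_at_least)
  case base
  then show ?case using f_Suc[of 0] by (simp add: f_0 w_0)
next
  case (Suc j)
  then have "j \<in> S" using S_interval by auto
  then have "w j \<noteq> 0" using w_add_neq[of j 0] w_0 by simp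
  then show ?case using Suc by (simp add: f_Suc)
qed

text \<open>The added element gives 1; the rest comes from \<open>{1..k - 1}\<close>, which
  \<open>f\<close> shifts up by one.\<close>

lemma image_S_interval: "{1..k} \<subseteq> f ` S \<union> {1}"
proof
  fix i assume i: "i \<in> {1..k}"
  show "i \<in> f ` S \<union> {1}"
  proof (cases "i = 1")
    case False
    then have "i - 1 \<in> {1..k - 1}" using i by auto
    then have "i - 1 \<in> S" "f (i - 1) = i" using S_interval f_interval[of "i - 1"] by auto
    then show ?thesis by (metis UnI1 imageI)
  qed simp
qed

text \<open>\<open>f\<close> starts at 0 and skips a number only after a zero of \<open>w\<close>,
  whose image has length two.\<close>

lemma position_cases:
  obtains n where "N = f n" | n where "N = Suc (f n)" "w n = 0"
proof -
  have "(\<exists>n. N = f n) \<or> (\<exists>n. N = Suc (f n) \<and> w n = 0)"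
  proof (induction N)
    case 0
    then show ?case by (auto intro: exI[of _ 0] simp: f_0)
  next
    case (Suc N)
    then show ?case
    proof (elim disjE exE conjE)
      show ?thesis if "N = f n" for n
        using that f_Suc[of n] by (cases "w n = 0") (auto intro: exI[of _ "Suc n"])
      show ?thesis if "N = Suc (f n)" "w n = 0" for n
        using that f_Suc[of n] by (auto intro: exI[of _ "Suc n"])
    qed
  qed
  then show ?thesis using that by blast
qed

lemma SG_image:
  assumes W_zero: "\<And>n. w n = 0 \<Longrightarrow> W (f n) = 0 \<and> W (Suc (f n)) = 1"
    and W_pos: "\<And>n. w n \<noteq> 0 \<Longrightarrow> W (f n) = Suc (w n)"
  shows "SG (f ` S \<union> {1}) N = W N"
proof -
  have W_0: "W 0 = 0" using W_zero[of 0] w_0 f_0 by simp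
  have W_f: "W (f n) = (if w n = 0 then 0 else Suc (w n))" for n
    using W_zero W_pos by simp
  have W_step: "W (Suc N) \<in> {0, Suc (W N)}" for N
  proof (cases rule: position_cases[of N])
    case (1 n)
    then show ?thesis
      using W_zero[of n] W_f[of "Suc n"] W_f[of n] w_step[of n] f_Suc[of n] by auto
  next
    case (2 n)
    then show ?thesis
      using W_zero[of n] W_f[of "Suc n"] w_step[of n] f_Suc[of n] by auto
  qed
  have W_diff: "j \<le> W N \<Longrightarrow> j \<le> N \<and> W (N - j) = W N - j" for j N
    using W_0 W_step by (rule staircase_diff)
  have zero: "\<exists>n. N = f n \<and> w n = 0" if "W N = 0" for N
  proof (cases rule: position_cases[of N])
    case (1 n)
    then show ?thesis using that W_pos[of n] by auto
  next
    case (2 n)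
    then show ?thesis using that W_zero[of n] by auto
  qed
  have top: "W N \<le> Suc k \<and> (W N = Suc k \<longrightarrow> (\<exists>n. N = f n \<and> w n = k))" for N
  proof (cases rule: position_cases[of N])
    case (1 n)
    then show ?thesis using W_f[of n] w_le[of n] by auto
  next
    case (2 n)
    then show ?thesis using W_zero[of n] k by auto
  qed
  show ?thesis
  proof (rule SG_eqI)
    fix N s'
    assume s': "s' \<in> f ` S \<union> {1}" "0 < s'" "s' \<le> N"
    show "W (N - s') \<noteq> W N"
    proof
      assume eq: "W (N - s') = W N"
      \<comment> \<open>Stepping back by the common letter gives two zeros of \<open>W\<close> at
        distance \<open>s'\<close>.\<close>
      have "W N \<le> N - s'" "W (N - s' - W N) = 0" "W (N - W N) = 0"
        using W_diff[of "W N" N] W_diff[of "W N" "N - s'"] eq by auto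
      then obtain m n where mn: "N - s' - W N = f m" "w m = 0" "N - W N = f n" "w n = 0"
        using zero by metis
      then have fn: "f n = f m + s'" using \<open>W N \<le> N - s'\<close> s' by linarith
      show False
      proof (cases "s' \<in> f ` S")
        case True
        then obtain s where s: "s \<in> S" "s' = f s" by blast
        then have "f n = f (m + s)" using fn f_add_S mn by simp
        then have "n = m + s" using strict_mono_f by (simp add: strict_mono_eq)
        then show False using w_add_neq[OF s(1), of m] mn by simp
      next
        case False
        \<comment> \<open>Here \<open>s' = 1\<close>, but \<open>f\<close> jumps by 2 at the zero
          \<open>m\<close>.\<close>
        then have "f m < f n" "f n < f (Suc m)" using fn s' mn f_Suc[of m] by auto
        then show False using strict_mono_f by (simp add: strict_mono_less)
      qed
    qed
  next
    fix N v
    assume v: "v < W N"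
    show "\<exists>s'\<in>f ` S \<union> {1}. 0 < s' \<and> s' \<le> N \<and> W (N - s') = v"
    \<comment> \<open>Drops of at most \<open>k\<close> are moves within a block; the only larger
      one is from \<open>k + 1\<close> to 0.\<close>
    proof (cases "W N - v \<le> k")
      case True
      then have "W N - v \<in> {1..k}" using v by auto
      then have "W N - v \<in> f ` S \<union> {1}" using image_S_interval by blast
      then show ?thesis
        using v W_diff[of "W N - v" N] by (intro bexI[of _ "W N - v"]) auto
    next
      case False
      then have "W N = Suc k" "v = 0" using top[of N] by auto
      then obtain n where n: "N = f n" "w n = k" using top by blast
      then have "0 < SG S n" using k w_nim[of n] by simp
      then obtain s where s: "s \<in> S" "0 < s" "s \<le> n" "w (n - s) = 0"
        by (metis SG_option w_nim)
      then have N: "N = f (n - s) + f s" using f_add_S[of s "n - s"] n by simp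
      have "0 < f s" using strict_monoD[OF strict_mono_f s(2)] by simp
      then show ?thesis
        using s N W_f[of "n - s"] \<open>v = 0\<close> by (intro bexI[of _ "f s"]) auto
    qed
  qed
qed

end

section \<open>The morphic image\<close>

lemma sdrop_apply_morphism:
  assumes "\<And>x. x \<in> sset w \<Longrightarrow> h x \<noteq> []" and "f 0 = 0"
    and "\<And>n. f (Suc n) = f n + length (h (w !! n))"
  shows "sdrop (f n) (apply_morphism h w) = h (w !! n) @- apply_morphism h (sdrop (Suc n) w)"
proof -
  have unfold: "apply_morphism h (sdrop n w) = h (w !! n) @- apply_morphism h (sdrop (Suc n) w)" for n
  proof -
    have "sdrop n w = w !! n ## sdrop (Suc n) w"
      by (rule stream.expand) (simp del: sdrop.simps)
    moreover have "h (w !! n) \<noteq> []" using assms(1) snth_sset[of w n] by blast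
    ultimately show ?thesis unfolding apply_morphism_def by (simp add: flat_unfold del: sdrop.simps)
  qed
  have "sdrop (f n) (apply_morphism h w) = apply_morphism h (sdrop n w)"
  proof (induction n)
    case 0
    then show ?case by (simp add: assms(2))
  next
    case (Suc n)
    have "sdrop (f (Suc n)) (apply_morphism h w) =
        sdrop (length (h (w !! n))) (apply_morphism h (sdrop n w))"
      by (metis Suc assms(3) sdrop_add add.commute)
    also have "\<dots> = apply_morphism h (sdrop (Suc n) w)"
      by (subst unfold) (simp add: sdrop_shift)
    finally show ?case .
  qed
  then show ?thesis using unfold by simp
qed

lemma apply_morphism_nth:
  assumes "\<And>x. x \<in> sset w \<Longrightarrow> h x \<noteq> []" and "f 0 = 0"
    and "\<And>n. f (Suc n) = f n + length (h (w !! n))"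
    and "j < length (h (w !! n))"
  shows "apply_morphism h w !! (f n + j) = h (w !! n) ! j"
proof -
  have "apply_morphism h w !! (f n + j) = sdrop (f n) (apply_morphism h w) !! j"
    by (simp add: sdrop_snth)
  then show ?thesis
    using sdrop_apply_morphism[of w h f n, OF assms(1-3)] assms(4) by simp
qed

text \<open>The pattern \<open>0 1 \<dots> k - 2, k\<close>, which greedy digits alone would allow, is excluded here: the
  Nim value \<open>k\<close> needs an option of value \<open>k - 1\<close>, which would put two zeros at a distance in \<open>S\<close>.\<close>

lemma representation_word_step:
  fixes a S
  defines "w \<equiv> \<lambda>n. representation_word a !! n"
  assumes "representing_seq a" and S_pos: "\<forall>s\<in>S. 0 < s" and "{1..a 1 - 1} \<subseteq> S"
    and nim: "\<And>n. w n = SG S n"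
  shows "w (Suc n) \<in> {0, Suc (w n)}"
proof (induction n rule: less_induct)
  case (less n)
  let ?k = "a 1"
  have k: "2 \<le> ?k" using assms(2) by (rule representing_seq_1_ge_2)
  have neq: "w (n + s) \<noteq> w n" if "s \<in> S" for n s
    using SG_diff_neq[of s S "n + s"] S_pos that by (simp add: nim)
  have w0: "w 0 = 0" using representation_word_0[OF assms(2)] by (simp add: w_def)
  have diff: "j \<le> i \<and> w (i - j) = w i - j" if "j \<le> w i" "i \<le> n" for i j
    using that less.IH by (intro staircase_diff w0) auto
  show ?case
  proof (rule ccontr)
    assume contr: "w (Suc n) \<notin> {0, Suc (w n)}"
    then have top: "w (Suc n) = ?k" "w (Suc (Suc n)) \<in> {0, ?k}"
      using representation_word_Suc_cases[OF assms(2), of n] by (auto simp: w_def)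
    have "1 \<in> S" using assms(4) k by auto
    then have nz: "w (Suc (Suc n)) = 0" "w n \<noteq> ?k"
      using neq[of 1 "Suc n"] neq[of 1 n] top by auto
    have le: "w n \<le> ?k" using representation_word_le[OF assms(2)] by (simp add: w_def)
    define z where "z = n - w n"
    have z: "w z = 0" "w n \<le> n" using diff[of "w n" n] by (auto simp: z_def)
    \<comment> \<open>The zeros \<open>z\<close> and \<open>n + 2\<close> are \<open>w n + 2\<close>
      apart.\<close>
    have "w n + 2 \<notin> S"
      using neq[of "w n + 2" z] z nz(1) by (auto simp: z_def)
    then have "w n + 2 \<notin> {1..?k - 1}" using assms(4) by blast
    \<comment> \<open>So \<open>w n \<ge> ?k - 2\<close>; the value \<open>?k - 1\<close> would make
      the step an increment, and \<open>?k\<close> is excluded by \<open>nz\<close>.\<close>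
    then have wn: "Suc (w n) = ?k - 1" using contr top nz(2) le by auto
    have "?k - 1 < SG S (Suc n)" using top k nim[of "Suc n"] by simp
    then obtain s where s: "s \<in> S" "0 < s" "s \<le> Suc n" "w (Suc n - s) = ?k - 1"
      by (metis SG_option nim)
    then have "?k - 1 \<le> Suc n - s" "w (Suc n - s - (?k - 1)) = 0"
      using diff[of "?k - 1" "Suc n - s"] by auto
    \<comment> \<open>As \<open>Suc (w n) = ?k - 1\<close>, the block of the option starts exactly
      \<open>s\<close> before \<open>z\<close>.\<close>
    moreover from this have "Suc n - s - (?k - 1) + s = z" using wn z s by (simp add: z_def)
    ultimately show False using neq[OF s(1), of "Suc n - s - (?k - 1)"] z by simp
  qed
qed

theorem theoremE5:
  fixes a :: "nat \<Rightarrow> nat" and k :: nat and S :: "nat set"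
  assumes "representing_seq a"
    and "a 1 = k"
    and "\<forall>s\<in>S. 0 < s"
    and "{1..k - 1} \<subseteq> S"
    and "representation_word a = nim_sequence S"
  shows "apply_morphism (phi k) (representation_word a)
           = nim_sequence (one_promotion_fun a ` S \<union> {1})"
proof -
  let ?w = "\<lambda>n. representation_word a !! n" and ?f = "one_promotion_fun a"
  let ?W = "apply_morphism (phi k) (representation_word a)"
  have nim: "?w n = SG S n" for n
    using assms(5) by (simp add: nim_sequence_def)
  have le: "?w n \<le> k" for n
    using representation_word_le[OF assms(1)] assms(2) by simp
  interpret nim_block_word k S ?w ?f
  proof
    show "2 \<le> k" using representing_seq_1_ge_2[OF assms(1)] assms(2) by simp
    show "?w (Suc n) \<in> {0, Suc (?w n)}" for n
      using assms nim by (intro representation_word_step) auto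
  qed (use assms(3,4) nim le representation_word_0[OF assms(1)] one_promotion_fun_Suc[OF assms(1)]
      in auto)
  have "?f (Suc n) = ?f n + length (phi k (?w n))" for n
    using le[of n] by (simp add: f_Suc phi_def)
  moreover have "phi k x \<noteq> []" if "x \<in> sset (representation_word a)" for x
    using that representation_word_alphabet[OF assms(1)] assms(2) by (auto simp: phi_def)
  ultimately have W: "?W !! (?f n + j) = phi k (?w n) ! j" if "j < length (phi k (?w n))" for n j
    using that by (intro apply_morphism_nth) auto
  have "SG (?f ` S \<union> {1}) N = ?W !! N" for N
  proof (rule SG_image)
    show "?W !! ?f n = 0 \<and> ?W !! Suc (?f n) = 1" if "?w n = 0" for n
      using that W[of 0 n] W[of 1 n] by (simp add: phi_def)
    show "?W !! ?f n = Suc (?w n)" if "?w n \<noteq> 0" for n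
      using that W[of 0 n] le[of n] by (simp add: phi_def)
  qed
  then have "?W !! N = nim_sequence (?f ` S \<union> {1}) !! N" for N
    by (simp add: nim_sequence_def)
  then show ?thesis by (metis smap_alt stream.map_id)
qed

end
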